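(* Let $(X,d)$ be a complete $\mathrm{CAT}(0)$ space. Then $(X,d)$ is locally compact if and only if it is regular, i.e. if and only if for every bounded nondecreasing chain $(K_\alpha)_{\alpha\in A}$ of compact subsets of $X$ the Painlevé–Kuratowski limit $\operatorname{Lim}_\alpha K_\alpha$ is compact.
   Context: A $\mathrm{CAT}(0)$ space is a geodesic metric space in which every geodesic triangle is at least as thin as its Euclidean comparison triangle. Let $(A,\preceq)$ be a directed set. A family $(S_\alpha)_{\alpha\in A}$ of subsets of $X$ is a net of sets; it is nondecreasing if $S_\alpha\subseteq S_\beta$ whenever $\alpha\preceq\beta$. It is a chain if for all $\alpha\ne\beta$ one has $S_\alpha\subseteq S_\beta$ or $S_\beta\subseteq S_\alpha$. It is bounded if $\bigcup_\alpha S_\alpha$ is a bounded set. With $\mathcal N(x)$ the collection of neighborhoods of $x$, the Painlevé–Kuratowski outer limit $\operatorname{Ls}_\alpha S_\alpha$ is the set of $x\in X$ such that for every $V\in\mathcal N(x)$ and every $\alpha_0\in A$ there is $\alpha\succeq\alpha_0$ with $V\cap S_\alpha\neq\emptyset$; the inner limit $\operatorname{Li}_\alpha S_\alpha$ is the set of $x\in X$ such that for every $V\in\mathcal N(x)$ there is $\alpha_0\in A$ with $V\cap S_\alpha\ne\emptyset$ for all $\alpha\succeq\alpha_0$. If the two coincide, the common set is the limit $\operatorname{Lim}_\alpha S_\alpha$. (For nondecreasing chains the limit always exists.) *)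

theory Defs
  imports "HOL-Analysis.Analysis"
begin

definition directed_set :: "'i set \<Rightarrow> ('i \<Rightarrow> 'i \<Rightarrow> bool) \<Rightarrow> bool" where
  "directed_set A le \<longleftrightarrow>
     A \<noteq> {} \<and> reflp_on A le \<and> transp_on A le \<and>
     (\<forall>\<alpha>\<in>A. \<forall>\<beta>\<in>A. \<exists>\<gamma>\<in>A. le \<alpha> \<gamma> \<and> le \<beta> \<gamma>)"

definition nondecreasing_net ::
    "'i set \<Rightarrow> ('i \<Rightarrow> 'i \<Rightarrow> bool) \<Rightarrow> ('i \<Rightarrow> 'a set) \<Rightarrow> bool" where
  "nondecreasing_net A le S \<longleftrightarrow> (\<forall>\<alpha>\<in>A. \<forall>\<beta>\<in>A. le \<alpha> \<beta> \<longrightarrow> S \<alpha> \<subseteq> S \<beta>)"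

definition chain_net :: "'i set \<Rightarrow> ('i \<Rightarrow> 'a set) \<Rightarrow> bool" where
  "chain_net A S \<longleftrightarrow> (\<forall>\<alpha>\<in>A. \<forall>\<beta>\<in>A. \<alpha> \<noteq> \<beta> \<longrightarrow> S \<alpha> \<subseteq> S \<beta> \<or> S \<beta> \<subseteq> S \<alpha>)"

definition neighborhoods :: "'a topology \<Rightarrow> 'a \<Rightarrow> 'a set set" where
  "neighborhoods X x = {V. V \<subseteq> topspace X \<and> (\<exists>U. openin X U \<and> x \<in> U \<and> U \<subseteq> V)}"

definition PK_outer_limit ::
    "'a topology \<Rightarrow> 'i set \<Rightarrow> ('i \<Rightarrow> 'i \<Rightarrow> bool) \<Rightarrow> ('i \<Rightarrow> 'a set) \<Rightarrow> 'a set" where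
  "PK_outer_limit X A le S =
     {x \<in> topspace X. \<forall>V\<in>neighborhoods X x. \<forall>\<alpha>\<^sub>0\<in>A. \<exists>\<alpha>\<in>A. le \<alpha>\<^sub>0 \<alpha> \<and> V \<inter> S \<alpha> \<noteq> {}}"

definition PK_inner_limit ::
    "'a topology \<Rightarrow> 'i set \<Rightarrow> ('i \<Rightarrow> 'i \<Rightarrow> bool) \<Rightarrow> ('i \<Rightarrow> 'a set) \<Rightarrow> 'a set" where
  "PK_inner_limit X A le S =
     {x \<in> topspace X. \<forall>V\<in>neighborhoods X x. \<exists>\<alpha>\<^sub>0\<in>A. \<forall>\<alpha>\<in>A. le \<alpha>\<^sub>0 \<alpha> \<longrightarrow> V \<inter> S \<alpha> \<noteq> {}}"

definition has_PK_limit ::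
    "'a topology \<Rightarrow> 'i set \<Rightarrow> ('i \<Rightarrow> 'i \<Rightarrow> bool) \<Rightarrow> ('i \<Rightarrow> 'a set) \<Rightarrow> 'a set \<Rightarrow> bool" where
  "has_PK_limit X A le S L \<longleftrightarrow> PK_outer_limit X A le S = L \<and> PK_inner_limit X A le S = L"

context Metric_space
begin

definition geodesic_path :: "(real \<Rightarrow> 'a) \<Rightarrow> 'a \<Rightarrow> 'a \<Rightarrow> bool" where
  "geodesic_path g x y \<longleftrightarrow>
     g ` {0..d x y} \<subseteq> M \<and> g 0 = x \<and> g (d x y) = y \<and>
     (\<forall>s\<in>{0..d x y}. \<forall>t\<in>{0..d x y}. d (g s) (g t) = \<bar>s - t\<bar>)"

definition geodesic_segment :: "'a \<Rightarrow> 'a \<Rightarrow> 'a set \<Rightarrow> bool" where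
  "geodesic_segment x y G \<longleftrightarrow> (\<exists>g. geodesic_path g x y \<and> G = g ` {0..d x y})"

definition geodesic_space :: bool where
  "geodesic_space \<longleftrightarrow> (\<forall>x\<in>M. \<forall>y\<in>M. \<exists>G. geodesic_segment x y G)"

definition comparison_triangle ::
    "'a \<Rightarrow> 'a \<Rightarrow> 'a \<Rightarrow> real ^ 2 \<Rightarrow> real ^ 2 \<Rightarrow> real ^ 2 \<Rightarrow> bool" where
  "comparison_triangle p q r p' q' r' \<longleftrightarrow>
     dist p' q' = d p q \<and> dist q' r' = d q r \<and> dist r' p' = d r p"

text \<open>Points of a side \<open>G\<close> issuing from \<open>p\<close>, paired with their comparison points on the
  Euclidean side from \<open>p'\<close> to \<open>q'\<close>.\<close>

definition comparison_points ::
    "'a set \<Rightarrow> 'a \<Rightarrow> real ^ 2 \<Rightarrow> real ^ 2 \<Rightarrow> ('a \<times> (real ^ 2)) set" where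
  "comparison_points G p p' q' =
     {(x, x'). x \<in> G \<and> x' \<in> closed_segment p' q' \<and> dist p' x' = d p x}"

definition CAT0 :: bool where
  "CAT0 \<longleftrightarrow> geodesic_space \<and>
     (\<forall>p\<in>M. \<forall>q\<in>M. \<forall>r\<in>M. \<forall>G\<^sub>1 G\<^sub>2 G\<^sub>3 p' q' r'.
        geodesic_segment p q G\<^sub>1 \<and> geodesic_segment q r G\<^sub>2 \<and> geodesic_segment r p G\<^sub>3 \<and>
        comparison_triangle p q r p' q' r' \<longrightarrow>
        (let C = comparison_points G\<^sub>1 p p' q' \<union> comparison_points G\<^sub>2 q q' r' \<union>
                 comparison_points G\<^sub>3 r r' p'
         in \<forall>(x, x')\<in>C. \<forall>(y, y')\<in>C. d x y \<le> dist x' y'))"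

text \<open>HOL cannot quantify over types inside a formula, so the type of the net indices is a
  parameter. For a finite index type the property is trivial: a directed set then has a largest
  element. It is therefore only meaningful for infinite index types.\<close>

definition PK_regular :: "'i itself \<Rightarrow> bool" where
  "PK_regular (_ :: 'i itself) \<longleftrightarrow>
     (\<forall>(A :: 'i set) le K.
        directed_set A le \<and> (\<forall>\<alpha>\<in>A. compactin mtopology (K \<alpha>)) \<and>
        nondecreasing_net A le K \<and> chain_net A K \<and> mbounded (\<Union>\<alpha>\<in>A. K \<alpha>) \<longrightarrow>
        (\<exists>L. has_PK_limit mtopology A le K L \<and> compactin mtopology L))"

end

locale CAT0_space = Metric_space +
  assumes CAT0: CAT0

end

(* The limit of a nondecreasing net is the closure of its union, and every sequence in a bounded set
   is exhausted by the increasing finite sets of its first terms. Hence, in a complete space,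
   regularity says exactly that bounded sets are totally bounded. For a geodesic space this is local
   compactness, by the Hopf-Rinow argument: the radii of totally bounded balls about a fixed centre
   form a set that is closed (the ball of radius R lies near the ball of any slightly smaller radius)
   and open (by a Lebesgue number). Of the CAT(0) condition, only the existence of geodesics
   enters. *)

theory Submission
  imports Defs
begin

text \<open>A neighborhood that meets one \<open>S \<alpha>0\<close> meets all later members by
  monotonicity, so closure points of the union lie in the inner limit. The inner limit lies in the
  outer one because the index it supplies and any prescribed index have a common upper
  bound.\<close>

lemma has_PK_limit_nondecreasing_net:
  assumes dir: "directed_set A le" and mono: "nondecreasing_net A le S"
  shows "has_PK_limit X A le S (X closure_of (\<Union>\<alpha>\<in>A. S \<alpha>))"
proof -
  have "PK_outer_limit X A le S \<subseteq> X closure_of (\<Union>\<alpha>\<in>A. S \<alpha>)"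
  proof
    fix x assume x: "x \<in> PK_outer_limit X A le S"
    obtain \<alpha>0 where \<alpha>0: "\<alpha>0 \<in> A"
      using dir by (auto simp: directed_set_def)
    have "\<exists>y\<in>\<Union>\<alpha>\<in>A. S \<alpha>. y \<in> T" if "x \<in> T" "openin X T" for T
    proof -
      have "T \<in> neighborhoods X x"
        using that openin_subset by (auto simp: neighborhoods_def)
      then show ?thesis
        using x \<alpha>0 unfolding PK_outer_limit_def by blast
    qed
    then show "x \<in> X closure_of (\<Union>\<alpha>\<in>A. S \<alpha>)"
      using x unfolding in_closure_of PK_outer_limit_def by blast
  qed
  moreover have "X closure_of (\<Union>\<alpha>\<in>A. S \<alpha>) \<subseteq> PK_inner_limit X A le S"
  proof
    fix x assume x: "x \<in> X closure_of (\<Union>\<alpha>\<in>A. S \<alpha>)"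
    have "\<exists>\<alpha>0\<in>A. \<forall>\<alpha>\<in>A. le \<alpha>0 \<alpha> \<longrightarrow> V \<inter> S \<alpha> \<noteq> {}" if V: "V \<in> neighborhoods X x" for V
    proof -
      obtain U where "openin X U" "x \<in> U" "U \<subseteq> V"
        using V by (auto simp: neighborhoods_def)
      then obtain y \<alpha>0 where "y \<in> V" "\<alpha>0 \<in> A" "y \<in> S \<alpha>0"
        using x unfolding in_closure_of by blast
      then show ?thesis
        using mono by (intro bexI[of _ \<alpha>0]) (auto simp: nondecreasing_net_def)
    qed
    then show "x \<in> PK_inner_limit X A le S"
      using x by (simp add: PK_inner_limit_def in_closure_of)
  qed
  moreover have "PK_inner_limit X A le S \<subseteq> PK_outer_limit X A le S"
    using dir unfolding PK_inner_limit_def PK_outer_limit_def directed_set_def by blast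
  ultimately show ?thesis
    unfolding has_PK_limit_def by blast
qed

context Metric_space
begin

lemma geodesic_space_intermediate_point:
  assumes "geodesic_space" "x \<in> M" "y \<in> M" "0 \<le> r" "r \<le> d x y"
  obtains z where "z \<in> M" "d x z = r" "d z y = d x y - r"
proof -
  obtain g where g: "geodesic_path g x y"
    using assms by (auto simp: geodesic_space_def geodesic_segment_def)
  have "0 \<in> {0..d x y}" "r \<in> {0..d x y}" "d x y \<in> {0..d x y}"
    using assms(4,5) by auto
  then have "g r \<in> M" "d (g 0) (g r) = \<bar>0 - r\<bar>" "d (g r) (g (d x y)) = \<bar>r - d x y\<bar>"
    using g unfolding geodesic_path_def by blast+
  moreover have "g 0 = x" "g (d x y) = y"
    using g by (auto simp: geodesic_path_def)
  ultimately show thesis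
    using assms(4,5) that[of "g r"] by simp
qed

text \<open>If \<open>y\<close> lies outside the smaller ball, stop on a geodesic from
  \<open>p\<close> to \<open>y\<close> at distance \<open>r\<close>: what remains has length
  \<open>d p y - r\<close>, at most \<open>e\<close>. Both Hopf-Rinow steps use geodesics only in
  this form.\<close>

lemma geodesic_space_near_smaller_mcball:
  assumes "geodesic_space" "y \<in> mcball p s" "0 \<le> r" "0 \<le> e" "s \<le> r + e"
  obtains z where "z \<in> mcball p r" "d z y \<le> e"
proof (cases "d p y \<le> r")
  case True
  then show thesis
    using assms by (intro that[of y]) auto
next
  case False
  then obtain z where "z \<in> M" "d p z = r" "d z y = d p y - r"
    using geodesic_space_intermediate_point[of p y r] assms by auto
  then show thesis
    using assms by (intro that[of z]) auto
qed

text \<open>Closedness step: a finite \<open>e/2\<close>-net of a ball whose radius is at most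
  \<open>e/2\<close> smaller is an \<open>e\<close>-net of the whole ball.\<close>

lemma mtotally_bounded_mcball_limit:
  assumes geo: "geodesic_space" and "0 < R"
    and tb: "\<And>r. r < R \<Longrightarrow> mtotally_bounded (mcball p r)"
  shows "mtotally_bounded (mcball p R)"
  unfolding mtotally_bounded_def
proof (intro strip)
  fix e :: real assume "e > 0"
  \<comment> \<open>The maximum keeps the radius nonnegative when \<open>e\<close> is large;
    \<open>0 < R\<close> still gives \<open>r < R\<close>.\<close>
  define r where "r = max 0 (R - e/2)"
  have r: "0 \<le> r" "r < R" "R \<le> r + e/2"
    using \<open>e > 0\<close> \<open>0 < R\<close> by (auto simp: r_def)
  have "e/2 > 0" using \<open>e > 0\<close> by simp
  then obtain K where K: "finite K" "K \<subseteq> mcball p r" "mcball p r \<subseteq> (\<Union>x\<in>K. mball x (e/2))"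
    using tb[OF r(2)] unfolding mtotally_bounded_def by metis
  have "mcball p R \<subseteq> (\<Union>x\<in>K. mball x e)"
  proof
    fix y assume y: "y \<in> mcball p R"
    then obtain z where z: "z \<in> mcball p r" "d z y \<le> e/2"
      using geodesic_space_near_smaller_mcball[OF geo y, of r "e/2"] r \<open>e > 0\<close> by auto
    then obtain k where "k \<in> K" "z \<in> mball k (e/2)"
      using K(3) by blast
    moreover have "d k y \<le> d k z + d z y"
      using calculation y by (intro triangle) auto
    ultimately show "y \<in> (\<Union>x\<in>K. mball x e)"
      using y z by auto
  qed
  moreover have "K \<subseteq> mcball p R"
    using K(2) r by force
  ultimately show "\<exists>K. finite K \<and> K \<subseteq> mcball p R \<and> mcball p R \<subseteq> (\<Union>x\<in>K. mball x e)"
    using K(1) by blast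
qed

text \<open>Openness step: balls of one common radius \<open>e\<close> about the points of the ball
  are totally bounded, and finitely many of them cover the ball enlarged by
  \<open>e/2\<close>.\<close>

lemma mtotally_bounded_mcball_extend:
  assumes geo: "geodesic_space" and "mcomplete" and lc: "locally_compact_space mtopology"
    and "0 \<le> R" and tb: "mtotally_bounded (mcball p R)"
  obtains e where "e > 0" "mtotally_bounded (mcball p (R + e))"
proof -
  \<comment> \<open>By local compactness these sets cover the ball, which is compact because it is
    closed in a complete space and totally bounded. A Lebesgue number of the cover is the common
    radius.\<close>
  define C where "C = {U. openin mtopology U \<and> mtotally_bounded U}"
  have "compactin mtopology (mcball p R)"
    using tb \<open>mcomplete\<close> by (metis closedin_mcball closure_of_closedin mtotally_bounded_eq_compact_closure_of)
  moreover have "mcball p R \<subseteq> \<Union>C"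
  proof
    fix x assume "x \<in> mcball p R"
    then have "x \<in> topspace mtopology" by simp
    then obtain U K where "openin mtopology U" "compactin mtopology K" "x \<in> U" "U \<subseteq> K"
      using lc unfolding locally_compact_space_def by blast
    then show "x \<in> \<Union>C"
      unfolding C_def using compactin_imp_mtotally_bounded mtotally_bounded_subset by blast
  qed
  moreover have "openin mtopology U" if "U \<in> C" for U
    using that by (simp add: C_def)
  ultimately obtain e where "e > 0" and e: "\<forall>x\<in>mcball p R. \<exists>U\<in>C. mball x e \<subseteq> U"
    using lebesgue_number[of "mcball p R" C] by blast
  then have tb_e: "mtotally_bounded (mball x e)" if "x \<in> mcball p R" for x
    using that mtotally_bounded_subset unfolding C_def by blast
  have "e/2 > 0" using \<open>e > 0\<close> by simp
  then obtain K where K: "finite K" "K \<subseteq> mcball p R" "mcball p R \<subseteq> (\<Union>x\<in>K. mball x (e/2))"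
    using tb unfolding mtotally_bounded_def by metis
  have "mcball p (R + e/2) \<subseteq> (\<Union>x\<in>K. mball x e)"
  proof
    fix y assume y: "y \<in> mcball p (R + e/2)"
    then obtain z where z: "z \<in> mcball p R" "d z y \<le> e/2"
      using geodesic_space_near_smaller_mcball[OF geo y, of R "e/2"] \<open>0 \<le> R\<close> \<open>e > 0\<close> by auto
    then obtain k where "k \<in> K" "z \<in> mball k (e/2)"
      using K(3) by blast
    moreover have "d k y \<le> d k z + d z y"
      using calculation y by (intro triangle) auto
    ultimately show "y \<in> (\<Union>x\<in>K. mball x e)"
      using y z by auto
  qed
  moreover have "mtotally_bounded (\<Union>x\<in>K. mball x e)"
    using K tb_e by (intro mtotally_bounded_Union) auto
  ultimately have "mtotally_bounded (mcball p (R + e/2))"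
    using mtotally_bounded_subset by blast
  with \<open>e/2 > 0\<close> show thesis
    by (rule that)
qed

theorem Hopf_Rinow:
  assumes geo: "geodesic_space" and "mcomplete" and lc: "locally_compact_space mtopology"
    and S: "mbounded S"
  shows "mtotally_bounded S"
proof -
  have "mtotally_bounded (mcball p r)" for p r
  proof (rule ccontr)
    assume nt: "\<not> mtotally_bounded (mcball p r)"
    define T where "T = {r. \<not> mtotally_bounded (mcball p r)}"
    define R where "R = Inf T"
    have pM: "p \<in> M"
      using nt by (metis mcball_eq_empty mtotally_bounded_empty)
    \<comment> \<open>This bounds \<open>T\<close> below by 0 and settles the case
      \<open>R = 0\<close>, to which the limit lemma does not apply.\<close>
    have nonpos: "mtotally_bounded (mcball p s)" if "s \<le> 0" for s
    proof -
      have "mcball p s \<subseteq> {p}"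
        using that pM by clarsimp (metis nonneg order_antisym order_trans zero)
      then show ?thesis
        using pM by (meson mtotally_bounded_sing mtotally_bounded_subset)
    qed
    have T: "T \<noteq> {}" "\<And>s. s \<in> T \<Longrightarrow> 0 \<le> s"
      using nt nonpos unfolding T_def by (blast, force intro: less_imp_le simp: not_le)
    then have "bdd_below T" by (meson bdd_belowI)
    have "0 \<le> R"
      unfolding R_def using T by (intro cInf_greatest)
    have below: "mtotally_bounded (mcball p s)" if "s < R" for s
      using that cInf_lower[OF _ \<open>bdd_below T\<close>, of s] by (auto simp: R_def T_def)
    have "mtotally_bounded (mcball p R)"
      using nonpos mtotally_bounded_mcball_limit[OF geo _ below] by (metis not_le)
    then obtain e where "e > 0" and e: "mtotally_bounded (mcball p (R + e))"
      using mtotally_bounded_mcball_extend geo \<open>mcomplete\<close> lc \<open>0 \<le> R\<close> by metis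
    \<comment> \<open>Total boundedness passes to smaller concentric balls, so no bad radius lies
      below \<open>R + e\<close>, against the choice of \<open>R\<close> as infimum.\<close>
    have "R + e \<le> s" if "s \<in> T" for s
    proof (rule ccontr)
      assume "\<not> R + e \<le> s"
      then have "mcball p s \<subseteq> mcball p (R + e)"
        by (intro mcball_subset_concentric) simp
      then show False
        using that e mtotally_bounded_subset unfolding T_def by blast
    qed
    then have "R + e \<le> R"
      unfolding R_def using T(1) cInf_greatest by blast
    then show False
      using \<open>e > 0\<close> by simp
  qed
  then show ?thesis
    using S mtotally_bounded_subset unfolding mbounded_def by blast
qed

lemma locally_compact_space_if_mtotally_bounded:
  assumes "mcomplete" and tb: "\<And>S. mbounded S \<Longrightarrow> mtotally_bounded S"
  shows "locally_compact_space mtopology"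
  unfolding locally_compact_space_def
proof
  fix x assume "x \<in> topspace mtopology"
  then have "x \<in> mball x 1" by simp
  moreover have "compactin mtopology (mtopology closure_of mball x 1)"
    using assms mtotally_bounded_eq_compact_closure_of by blast
  moreover have "mball x 1 \<subseteq> mtopology closure_of mball x 1"
    by (intro closure_of_subset) auto
  ultimately show "\<exists>U K. openin mtopology U \<and> compactin mtopology K \<and> x \<in> U \<and> U \<subseteq> K"
    using openin_mball by blast
qed

lemma PK_regular_if_mtotally_bounded:
  assumes "mcomplete" and tb: "\<And>S. mbounded S \<Longrightarrow> mtotally_bounded S"
  shows "PK_regular TYPE('i)"
  unfolding PK_regular_def
proof (intro allI impI, elim conjE)
  fix A :: "'i set" and le and K :: "'i \<Rightarrow> 'a set"
  assume "directed_set A le" "nondecreasing_net A le K" "mbounded (\<Union>\<alpha>\<in>A. K \<alpha>)"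
  then show "\<exists>L. has_PK_limit mtopology A le K L \<and> compactin mtopology L"
    using has_PK_limit_nondecreasing_net tb mtotally_bounded_eq_compact_closure_of[OF \<open>mcomplete\<close>]
    by metis
qed

text \<open>Regularity is tested on the sets of first terms of a sequence. Their limit is the
  closure of its range; once this is compact, the range is totally bounded and the sequence has a
  Cauchy subsequence.\<close>

lemma mtotally_bounded_if_PK_regular:
  assumes inf: "infinite (UNIV :: 'i set)" and reg: "PK_regular TYPE('i)" and S: "mbounded S"
  shows "mtotally_bounded S"
  unfolding mtotally_bounded_sequentially
proof (intro conjI strip)
  show "S \<subseteq> M"
    using S by (rule mbounded_subset_mspace)
  fix \<sigma> :: "nat \<Rightarrow> 'a" assume \<sigma>: "range \<sigma> \<subseteq> S"
  obtain f :: "nat \<Rightarrow> 'i" where "inj f"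
    using inf unfolding infinite_iff_countable_subset by blast
  \<comment> \<open>The index set is a copy of the natural numbers inside the index type, ordered
    through \<open>inv f\<close>. Off \<open>A\<close> the values of \<open>inv f\<close> are
    unspecified, but \<open>le\<close> is a total preorder whatever they are.\<close>
  define A where "A = range f"
  define le where "le i j \<longleftrightarrow> inv f i \<le> inv f j" for i j
  define K where "K i = \<sigma> ` {..inv f i}" for i
  have \<sigma>_eq: "(\<Union>i\<in>A. K i) = range \<sigma>"
    using \<open>inj f\<close> by (auto simp: A_def K_def)
  have "\<exists>k\<in>A. le i k \<and> le j k" for i j
    using \<open>inj f\<close>
    by (intro bexI[of _ "f (max (inv f i) (inv f j))"]) (auto simp: A_def le_def)
  then have dir: "directed_set A le"
    unfolding directed_set_def by (auto simp: A_def le_def reflp_on_def transp_on_def)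
  have mono: "nondecreasing_net A le K"
    by (auto simp: nondecreasing_net_def le_def K_def)
  have chain: "chain_net A K"
    unfolding chain_net_def K_def by (metis atMost_subset_iff image_mono nle_le)
  have "compactin mtopology (K i)" for i
    using \<sigma> \<open>S \<subseteq> M\<close> by (intro finite_imp_compactin) (auto simp: K_def)
  moreover have "mbounded (\<Union>i\<in>A. K i)"
    unfolding \<sigma>_eq using S \<sigma> by (rule mbounded_subset)
  ultimately obtain L where "has_PK_limit mtopology A le K L" "compactin mtopology L"
    using reg dir mono chain unfolding PK_regular_def by blast
  \<comment> \<open>A limit is unique, being equal to the outer limit, so \<open>L\<close> is this
    closure.\<close>
  then have "compactin mtopology (mtopology closure_of range \<sigma>)"
    using has_PK_limit_nondecreasing_net[OF dir mono, of mtopology]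
    by (auto simp: has_PK_limit_def \<sigma>_eq)
  then have "mtotally_bounded (range \<sigma>)"
    using \<sigma> \<open>S \<subseteq> M\<close> by (intro compact_closure_of_imp_mtotally_bounded) auto
  then show "\<exists>r. strict_mono r \<and> MCauchy (\<sigma> \<circ> r)"
    unfolding mtotally_bounded_sequentially by blast
qed

end

theorem corollary1:
  fixes M :: "'a set" and d :: "'a \<Rightarrow> 'a \<Rightarrow> real"
  assumes "CAT0_space M d"
    and "Metric_space.mcomplete M d"
    and "infinite (UNIV :: 'i set)"
  shows "locally_compact_space (Metric_space.mtopology M d) \<longleftrightarrow>
         Metric_space.PK_regular M d TYPE('i)"
proof -
  interpret CAT0_space M d by fact
  have "geodesic_space"
    using CAT0 by (simp add: CAT0_def)
  then show ?thesis
    using assms(2,3) Hopf_Rinow PK_regular_if_mtotally_bounded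
      mtotally_bounded_if_PK_regular locally_compact_space_if_mtotally_bounded
    by metis
qed

end
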